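(* Let $U$ be a consistent c.e. theory that is effectively ef-essentially incomplete. Then there is a c.e. set $\mathcal X$ of sentences such that $U$ is effectively ef-essentially $\mathcal X$-incomplete and every $\phi\in\mathcal X$ is consistent with $U$.
   Context: Sentences are identified with Gödel numbers. For a set $\mathcal X$ of sentences, $U$ is effectively ef-essentially $\mathcal X$-incomplete iff there is a computable function $\Phi$ on sentences such that for every sentence $\phi$ of the language of $U$ with $U\cup\{\phi\}$ consistent, $\Phi(\phi)$ is independent of $U\cup\{\phi\}$ and $\Phi(\phi)\in\mathcal X$. "Effectively ef-essentially incomplete" is the case where $\mathcal X$ is the set of all sentences. *)

theory Defs
  imports Main "HOL-Library.Nat_Bijection"
begin

section \<open>Computability\<close>

text \<open>
  Kleene's \<open>\<mu>\<close>-recursive functions. Programs carry no explicit arity: the arity is the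
  length of the argument list, and evaluation is undefined if an argument is missing.
\<close>

datatype recf =
    Zero
  | Succ
  | Proj nat
  | Comp recf "recf list"
  | PrimRec recf recf
  | Mu recf

inductive evaluates :: "recf \<Rightarrow> nat list \<Rightarrow> nat \<Rightarrow> bool" where
  zero: "evaluates Zero xs 0"
| succ: "evaluates Succ (x # xs) (Suc x)"
| proj: "i < length xs \<Longrightarrow> evaluates (Proj i) xs (xs ! i)"
| comp: "list_all2 (\<lambda>g y. evaluates g xs y) gs ys \<Longrightarrow> evaluates f ys z \<Longrightarrow>
         evaluates (Comp f gs) xs z"
| prim_0: "evaluates f xs y \<Longrightarrow> evaluates (PrimRec f g) (0 # xs) y"
| prim_Suc: "evaluates (PrimRec f g) (n # xs) y \<Longrightarrow> evaluates g (n # y # xs) z \<Longrightarrow>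
         evaluates (PrimRec f g) (Suc n # xs) z"
| mu: "evaluates f (n # xs) 0 \<Longrightarrow> (\<forall>m<n. \<exists>y. evaluates f (m # xs) (Suc y)) \<Longrightarrow>
         evaluates (Mu f) xs n"

definition computable :: "(nat \<Rightarrow> nat) \<Rightarrow> bool" where
  "computable f \<longleftrightarrow> (\<exists>p. \<forall>x. evaluates p [x] (f x))"

text \<open>A set is c.e. if it is the domain of a partial computable function.\<close>

definition ce :: "nat set \<Rightarrow> bool" where
  "ce A \<longleftrightarrow> (\<exists>p. \<forall>x. x \<in> A \<longleftrightarrow> (\<exists>y. evaluates p [x] y))"

section \<open>First-order languages with equality\<close>

text \<open>
  Function and relation symbols are natural numbers; the language assigns each symbol that
  belongs to it an arity, and \<open>None\<close> to all other numbers. Constants are 0-ary function symbols.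
\<close>

record lang =
  fun_arity :: "nat \<Rightarrow> nat option"
  rel_arity :: "nat \<Rightarrow> nat option"

definition computable_lang :: "lang \<Rightarrow> bool" where
  "computable_lang L \<longleftrightarrow>
     computable (\<lambda>n. case fun_arity L n of None \<Rightarrow> 0 | Some k \<Rightarrow> Suc k) \<and>
     computable (\<lambda>n. case rel_arity L n of None \<Rightarrow> 0 | Some k \<Rightarrow> Suc k)"

text \<open>Variables are de Bruijn indices.\<close>

datatype tm = Var nat | Fn nat "tm list"

datatype fm = Fls | Rel nat "tm list" | Eq tm tm | Imp fm fm | All fm

abbreviation Neg :: "fm \<Rightarrow> fm" where
  "Neg A \<equiv> Imp A Fls"

primrec tm_in :: "lang \<Rightarrow> tm \<Rightarrow> bool" where
  "tm_in L (Var n) \<longleftrightarrow> True"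
| "tm_in L (Fn f ts) \<longleftrightarrow> fun_arity L f = Some (length ts) \<and> list_all (tm_in L) ts"

primrec fm_in :: "lang \<Rightarrow> fm \<Rightarrow> bool" where
  "fm_in L Fls \<longleftrightarrow> True"
| "fm_in L (Rel r ts) \<longleftrightarrow> rel_arity L r = Some (length ts) \<and> list_all (tm_in L) ts"
| "fm_in L (Eq s t) \<longleftrightarrow> tm_in L s \<and> tm_in L t"
| "fm_in L (Imp A B) \<longleftrightarrow> fm_in L A \<and> fm_in L B"
| "fm_in L (All A) \<longleftrightarrow> fm_in L A"

primrec tm_vars :: "tm \<Rightarrow> nat set" where
  "tm_vars (Var n) = {n}"
| "tm_vars (Fn f ts) = \<Union> (set (map tm_vars ts))"

primrec free_vars :: "fm \<Rightarrow> nat set" where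
  "free_vars Fls = {}"
| "free_vars (Rel r ts) = \<Union> (set (map tm_vars ts))"
| "free_vars (Eq s t) = tm_vars s \<union> tm_vars t"
| "free_vars (Imp A B) = free_vars A \<union> free_vars B"
| "free_vars (All A) = {n. Suc n \<in> free_vars A}"

definition sentences :: "lang \<Rightarrow> fm set" where
  "sentences L = {A. fm_in L A \<and> free_vars A = {}}"

primrec tm_subst :: "(nat \<Rightarrow> tm) \<Rightarrow> tm \<Rightarrow> tm" where
  "tm_subst \<sigma> (Var n) = \<sigma> n"
| "tm_subst \<sigma> (Fn f ts) = Fn f (map (tm_subst \<sigma>) ts)"

definition under_binder :: "(nat \<Rightarrow> tm) \<Rightarrow> nat \<Rightarrow> tm" where
  "under_binder \<sigma> = case_nat (Var 0) (\<lambda>n. tm_subst (\<lambda>i. Var (Suc i)) (\<sigma> n))"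

primrec fm_subst :: "(nat \<Rightarrow> tm) \<Rightarrow> fm \<Rightarrow> fm" where
  "fm_subst \<sigma> Fls = Fls"
| "fm_subst \<sigma> (Rel r ts) = Rel r (map (tm_subst \<sigma>) ts)"
| "fm_subst \<sigma> (Eq s t) = Eq (tm_subst \<sigma> s) (tm_subst \<sigma> t)"
| "fm_subst \<sigma> (Imp A B) = Imp (fm_subst \<sigma> A) (fm_subst \<sigma> B)"
| "fm_subst \<sigma> (All A) = All (fm_subst (under_binder \<sigma>) A)"

definition shift :: "fm \<Rightarrow> fm" where
  "shift = fm_subst (\<lambda>n. Var (Suc n))"

text \<open>Replace variable 0 by \<open>t\<close> and lower the remaining variables by one.\<close>

definition inst :: "tm \<Rightarrow> fm \<Rightarrow> fm" where
  "inst t = fm_subst (case_nat t Var)"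

section \<open>Provability\<close>

text \<open>
  Classical natural deduction, with all formulas taken from the language \<open>L\<close>. Shifting the
  hypotheses in \<open>AllI\<close> makes variable 0 the eigenvariable.
\<close>

inductive proves :: "lang \<Rightarrow> fm set \<Rightarrow> fm \<Rightarrow> bool" for L where
  Assm: "A \<in> \<Gamma> \<Longrightarrow> fm_in L A \<Longrightarrow> proves L \<Gamma> A"
| ImpI: "fm_in L A \<Longrightarrow> proves L (insert A \<Gamma>) B \<Longrightarrow> proves L \<Gamma> (Imp A B)"
| ImpE: "proves L \<Gamma> (Imp A B) \<Longrightarrow> proves L \<Gamma> A \<Longrightarrow> proves L \<Gamma> B"
| Classical: "fm_in L A \<Longrightarrow> proves L (insert (Neg A) \<Gamma>) Fls \<Longrightarrow> proves L \<Gamma> A"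
| AllI: "proves L (shift ` \<Gamma>) A \<Longrightarrow> proves L \<Gamma> (All A)"
| AllE: "proves L \<Gamma> (All A) \<Longrightarrow> tm_in L t \<Longrightarrow> proves L \<Gamma> (inst t A)"
| EqRefl: "tm_in L t \<Longrightarrow> proves L \<Gamma> (Eq t t)"
| EqSubst: "fm_in L A \<Longrightarrow> proves L \<Gamma> (Eq s t) \<Longrightarrow> proves L \<Gamma> (inst s A) \<Longrightarrow>
     proves L \<Gamma> (inst t A)"

definition consistent :: "lang \<Rightarrow> fm set \<Rightarrow> bool" where
  "consistent L U \<longleftrightarrow> \<not> proves L U Fls"

definition independent :: "lang \<Rightarrow> fm set \<Rightarrow> fm \<Rightarrow> bool" where
  "independent L U A \<longleftrightarrow> \<not> proves L U A \<and> \<not> proves L U (Neg A)"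

section \<open>Goedel numbers\<close>

primrec tm_code :: "tm \<Rightarrow> nat" where
  "tm_code (Var n) = prod_encode (0, n)"
| "tm_code (Fn f ts) = prod_encode (1, prod_encode (f, list_encode (map tm_code ts)))"

primrec godel_num :: "fm \<Rightarrow> nat" where
  "godel_num Fls = prod_encode (0, 0)"
| "godel_num (Rel r ts) = prod_encode (1, prod_encode (r, list_encode (map tm_code ts)))"
| "godel_num (Eq s t) = prod_encode (2, prod_encode (tm_code s, tm_code t))"
| "godel_num (Imp A B) = prod_encode (3, prod_encode (godel_num A, godel_num B))"
| "godel_num (All A) = prod_encode (4, godel_num A)"

lemma tm_code_inject: "tm_code s = tm_code t \<Longrightarrow> s = t"
proof (induction s arbitrary: t)
  case (Var n)
  then show ?case by (cases t) auto
next
  case (Fn f ss)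
  show ?case
  proof (cases t)
    case (Var n)
    then show ?thesis using Fn.prems by simp
  next
    case (Fn g ts)
    then have "f = g" and "map tm_code ss = map tm_code ts"
      using Fn.prems by (auto simp: inj_eq[OF inj_list_encode])
    moreover from this(2) have "ss = ts"
      using Fn.IH by (metis list.inj_map_strong)
    ultimately show ?thesis using Fn by simp
  qed
qed

lemma inj_godel_num: "inj godel_num"
proof -
  have [simp]: "map tm_code ss = map tm_code ts \<longleftrightarrow> ss = ts" for ss ts
    by (simp add: inj_eq inj_def inj_mapI tm_code_inject)
  have "godel_num A = godel_num B \<Longrightarrow> A = B" for A B
  proof (induction A arbitrary: B)
    case (Rel r ts)
    then show ?case by (cases B) (auto simp: inj_eq[OF inj_list_encode])
  qed (case_tac [!] B; auto dest: tm_code_inject)+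
  then show ?thesis by (auto intro: injI)
qed

definition ce_sentences :: "lang \<Rightarrow> fm set \<Rightarrow> bool" where
  "ce_sentences L X \<longleftrightarrow> X \<subseteq> sentences L \<and> ce (godel_num ` X)"

definition computable_on_sentences :: "lang \<Rightarrow> (fm \<Rightarrow> fm) \<Rightarrow> bool" where
  "computable_on_sentences L \<Phi> \<longleftrightarrow>
     (\<forall>\<phi>\<in>sentences L. \<Phi> \<phi> \<in> sentences L) \<and>
     (\<exists>f. computable f \<and> (\<forall>\<phi>\<in>sentences L. f (godel_num \<phi>) = godel_num (\<Phi> \<phi>)))"

section \<open>Effective essential incompleteness\<close>

text \<open>A c.e. theory is given by an arbitrary c.e. set of axioms, deductively closed or not.\<close>

definition ce_theory :: "lang \<Rightarrow> fm set \<Rightarrow> bool" where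
  "ce_theory L U \<longleftrightarrow> computable_lang L \<and> ce_sentences L U"

definition eff_ef_ess_incomplete_in :: "lang \<Rightarrow> fm set \<Rightarrow> fm set \<Rightarrow> bool" where
  "eff_ef_ess_incomplete_in L X U \<longleftrightarrow>
     (\<exists>\<Phi>. computable_on_sentences L \<Phi> \<and>
       (\<forall>\<phi>\<in>sentences L. consistent L (U \<union> {\<phi>}) \<longrightarrow>
          independent L (U \<union> {\<phi>}) (\<Phi> \<phi>) \<and> \<Phi> \<phi> \<in> X))"

definition eff_ef_ess_incomplete :: "lang \<Rightarrow> fm set \<Rightarrow> bool" where
  "eff_ef_ess_incomplete L U \<longleftrightarrow> eff_ef_ess_incomplete_in L (sentences L) U"

end

theory Submission imports Defs begin

text \<open>
  If \<open>\<Phi>\<close> witnesses effective incompleteness, so does \<open>\<Psi> \<phi> = (\<phi> \<longrightarrow> \<Phi> \<phi>)\<close>, because \<open>\<Psi> \<phi>\<close> and \<open>\<Phi> \<phi>\<close>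
  are equivalent over \<open>U \<union> {\<phi>}\<close>. Moreover \<open>\<Psi> \<phi>\<close> is always consistent with \<open>U\<close>: if \<open>U \<union> {\<phi>}\<close> is
  consistent, then \<open>U \<union> {\<phi>}\<close> does not refute \<open>\<Psi> \<phi>\<close>; otherwise \<open>U\<close> refutes \<open>\<phi>\<close> and hence proves \<open>\<Psi> \<phi>\<close>.
  So the range of \<open>\<Psi>\<close> is the required set. It is c.e. because sentences can be recognized
  effectively: a stack of syntactic objects still to be checked is processed until it is empty.
\<close>

section \<open>Recursive functions\<close>

text \<open>Single-valuedness is what lets a halting search be read backwards in
  \<open>ce_projection\<close>: the zero met by the program is the value of the function it
  computes.\<close>

lemma evaluates_deterministic: "evaluates p xs y \<Longrightarrow> evaluates p xs z \<Longrightarrow> y = z"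
proof (induction arbitrary: z rule: evaluates.induct)
  case (zero xs)
  then show ?case by cases auto
next
  case (succ x xs)
  then show ?case by cases auto
next
  case (proj i xs)
  from proj.prems show ?case by cases auto
next
  case (prim_0 f xs y g)
  from prim_0.prems show ?case by cases (use prim_0.IH in blast)
next
  case (comp xs gs ys f y)
  from comp.prems obtain zs where zs: "list_all2 (\<lambda>g y. evaluates g xs y) gs zs"
    and z: "evaluates f zs z"
    by cases auto
  have "ys = zs"
    using comp.IH(1) zs by (auto simp: list_all2_conv_all_nth intro: nth_equalityI)
  then show ?case using comp.IH(2) z by blast
next
  case (prim_Suc f g n xs y u)
  from prim_Suc.prems show ?case
    by cases (use prim_Suc.IH in blast)
next
  case (mu f n xs)
  from mu.prems have 0: "evaluates f (z # xs) 0"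
    and less: "\<forall>m<z. \<exists>y. evaluates f (m # xs) (Suc y)"
    by (cases, auto)+
  \<comment> \<open>If the two results differed, then at the smaller one \<open>f\<close> would have
    both the value \<open>0\<close> and a successor value.\<close>
  show ?case
  proof (rule linorder_cases[of n z])
    assume "n < z"
    then show ?thesis using less mu.IH(1) by blast
  next
    assume "z < n"
    then show ?thesis using 0 mu.IH(2) by blast
  qed
qed

text \<open>Programs carry no arity, so it is imposed on the length of the argument list; values of
  \<open>F\<close> on lists of other lengths are irrelevant.\<close>

definition recursive :: "nat \<Rightarrow> (nat list \<Rightarrow> nat) \<Rightarrow> bool" where
  "recursive n F \<longleftrightarrow> (\<exists>p. \<forall>xs. length xs = n \<longrightarrow> evaluates p xs (F xs))"

lemma recursive_cong:
  "recursive n F \<Longrightarrow> (\<And>xs. length xs = n \<Longrightarrow> F xs = G xs) \<Longrightarrow> recursive n G"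
  unfolding recursive_def by metis

lemma computable_iff_recursive: "computable f \<longleftrightarrow> recursive 1 (\<lambda>xs. f (xs ! 0))"
proof -
  have "(\<forall>xs. length xs = 1 \<longrightarrow> evaluates p xs (f (xs ! 0))) \<longleftrightarrow> (\<forall>x. evaluates p [x] (f x))" for p
    by (auto simp: length_Suc_conv)
  then show ?thesis unfolding computable_def recursive_def by simp
qed

lemma recursive_nth: "i < n \<Longrightarrow> recursive n (\<lambda>xs. xs ! i)"
  unfolding recursive_def using evaluates.proj by metis

lemma recursive_compose:
  assumes "recursive (length Gs) F" and "\<forall>G\<in>set Gs. recursive n G"
  shows "recursive n (\<lambda>xs. F (map (\<lambda>G. G xs) Gs))"
proof -
  obtain p where p: "\<And>xs. length xs = length Gs \<Longrightarrow> evaluates p xs (F xs)"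
    using assms(1) unfolding recursive_def by blast
  obtain q where q: "\<And>G xs. G \<in> set Gs \<Longrightarrow> length xs = n \<Longrightarrow> evaluates (q G) xs (G xs)"
    using assms(2) unfolding recursive_def by metis
  have "evaluates (Comp p (map q Gs)) xs (F (map (\<lambda>G. G xs) Gs))" if "length xs = n" for xs
    by (rule evaluates.comp[where ys = "map (\<lambda>G. G xs) Gs"])
      (use p q that in \<open>auto simp: list_all2_conv_all_nth\<close>)
  then show ?thesis unfolding recursive_def by blast
qed

lemma recursive_unary:
  assumes "computable f" and "recursive n G"
  shows "recursive n (\<lambda>xs. f (G xs))"
  using recursive_compose[of "[G]" "\<lambda>xs. f (xs ! 0)" n] assms
  by (simp add: computable_iff_recursive)

lemma recursive_binary:
  assumes "recursive 2 (\<lambda>xs. f (xs ! 0) (xs ! 1))" and "recursive n G" and "recursive n H"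
  shows "recursive n (\<lambda>xs. f (G xs) (H xs))"
  using recursive_compose[of "[G, H]" "\<lambda>xs. f (xs ! 0) (xs ! 1)" n] assms
  by (simp add: numeral_2_eq_2)

lemma recursive_ternary:
  assumes "recursive 3 (\<lambda>xs. f (xs ! 0) (xs ! 1) (xs ! 2))"
    and "recursive n G" and "recursive n H" and "recursive n K"
  shows "recursive n (\<lambda>xs. f (G xs) (H xs) (K xs))"
  using recursive_compose[of "[G, H, K]" "\<lambda>xs. f (xs ! 0) (xs ! 1) (xs ! 2)" n] assms
  by (simp add: numeral_3_eq_3 numeral_2_eq_2)

lemma recursive_Suc:
  assumes "recursive n F"
  shows "recursive n (\<lambda>xs. Suc (F xs))"
proof -
  have "computable Suc"
    unfolding computable_def using evaluates.succ by metis
  then show ?thesis using assms by (rule recursive_unary)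
qed

lemma recursive_const: "recursive n (\<lambda>xs. c)"
proof (induction c)
  case 0
  then show ?case unfolding recursive_def using evaluates.zero by metis
next
  case (Suc c)
  then show ?case by (rule recursive_Suc)
qed

lemma recursive_primrec:
  assumes "recursive n F" and "recursive (Suc (Suc n)) G"
    and H_0: "\<And>xs. length xs = n \<Longrightarrow> H (0 # xs) = F xs"
    and H_Suc: "\<And>m xs. length xs = n \<Longrightarrow> H (Suc m # xs) = G (m # H (m # xs) # xs)"
  shows "recursive (Suc n) H"
proof -
  obtain p q where p: "\<And>xs. length xs = n \<Longrightarrow> evaluates p xs (F xs)"
    and q: "\<And>xs. length xs = Suc (Suc n) \<Longrightarrow> evaluates q xs (G xs)"
    using assms(1,2) unfolding recursive_def by blast
  have "evaluates (PrimRec p q) (m # xs) (H (m # xs))" if "length xs = n" for m xs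
  proof (induction m)
    case 0
    show ?case using p[OF that] H_0[OF that] by (auto intro: evaluates.prim_0)
  next
    case (Suc m)
    have "evaluates q (m # H (m # xs) # xs) (H (Suc m # xs))"
      using q[of "m # H (m # xs) # xs"] that H_Suc[OF that] by simp
    with Suc show ?case by (rule evaluates.prim_Suc)
  qed
  then show ?thesis unfolding recursive_def by (metis length_Suc_conv)
qed

text \<open>Since \<open>F\<close> is total with a zero, the search of \<open>Mu\<close> ends: below
  the least zero all values are successors.\<close>

lemma recursive_Least:
  assumes "recursive (Suc n) F" and ex: "\<And>xs. length xs = n \<Longrightarrow> \<exists>y. F (y # xs) = 0"
  shows "recursive n (\<lambda>xs. LEAST y. F (y # xs) = 0)"
proof -
  obtain p where p: "\<And>xs. length xs = Suc n \<Longrightarrow> evaluates p xs (F xs)"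
    using assms(1) unfolding recursive_def by blast
  have "evaluates (Mu p) xs (LEAST y. F (y # xs) = 0)" if "length xs = n" for xs
  proof (rule evaluates.mu)
    have "F ((LEAST y. F (y # xs) = 0) # xs) = 0"
      using ex[OF that] by (rule LeastI_ex)
    then show "evaluates p ((LEAST y. F (y # xs) = 0) # xs) 0"
      using p[of "(LEAST y. F (y # xs) = 0) # xs"] that by simp
    show "\<forall>m<LEAST y. F (y # xs) = 0. \<exists>y. evaluates p (m # xs) (Suc y)"
      using p[of "_ # xs"] that not_less_Least[of _ "\<lambda>y. F (y # xs) = 0"]
      by (metis length_Cons not0_implies_Suc)
  qed
  then show ?thesis unfolding recursive_def by blast
qed

text \<open>The unbounded search for \<open>t\<close> is itself the required program, as it halts on
  \<open>x\<close> exactly when a zero exists. Later \<open>t\<close> is the number of steps of the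
  sentence checker.\<close>

lemma ce_projection:
  assumes "recursive 2 F" and A: "\<And>x. x \<in> A \<longleftrightarrow> (\<exists>t. F [t, x] = 0)"
  shows "ce A"
proof -
  obtain p where p: "\<And>t x. evaluates p [t, x] (F [t, x])"
    using assms(1) unfolding recursive_def by (metis length_Cons list.size(3) numeral_2_eq_2)
  have "x \<in> A \<longleftrightarrow> (\<exists>y. evaluates (Mu p) [x] y)" for x
  proof
    assume "x \<in> A"
    then have ex: "\<exists>t. F [t, x] = 0" using A by blast
    define y where "y = (LEAST t. F [t, x] = 0)"
    have "evaluates (Mu p) [x] y"
    proof (rule evaluates.mu)
      show "evaluates p [y, x] 0"
        using p[of y x] LeastI_ex[OF ex] by (simp add: y_def)
      show "\<forall>m<y. \<exists>y. evaluates p [m, x] (Suc y)"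
        using p[of _ x] not_less_Least[of _ "\<lambda>t. F [t, x] = 0"] unfolding y_def
        by (metis not0_implies_Suc)
    qed
    then show "\<exists>y. evaluates (Mu p) [x] y" ..
  next
    assume "\<exists>y. evaluates (Mu p) [x] y"
    then obtain y where "evaluates p [y, x] 0" by (auto elim: evaluates.cases)
    then have "F [y, x] = 0" using p evaluates_deterministic by blast
    then show "x \<in> A" using A by blast
  qed
  then show ?thesis unfolding ce_def by blast
qed

text \<open>Primitive recursion with one parameter, already composed: \<open>F\<close> supplies the
  number of rounds and \<open>G\<close> the parameter. The arithmetic functions and iteration below
  are instances.\<close>

lemma recursive_rec_nat:
  assumes "computable g" and "recursive 3 (\<lambda>xs. h (xs ! 0) (xs ! 1) (xs ! 2))"
    and "recursive n F" and "recursive n G"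
  shows "recursive n (\<lambda>xs. rec_nat (g (G xs)) (\<lambda>k y. h k y (G xs)) (F xs))"
proof (rule recursive_binary[OF _ assms(3,4)])
  have "recursive (Suc 1) (\<lambda>xs. rec_nat (g (xs ! 1)) (\<lambda>k y. h k y (xs ! 1)) (xs ! 0))"
    by (rule recursive_primrec[of 1 "\<lambda>xs. g (xs ! 0)" "\<lambda>xs. h (xs ! 0) (xs ! 1) (xs ! 2)"])
      (use assms(1,2) in \<open>auto simp: computable_iff_recursive numeral_3_eq_3\<close>)
  then show "recursive 2 (\<lambda>xs. rec_nat (g (xs ! 1)) (\<lambda>k y. h k y (xs ! 1)) (xs ! 0))"
    by (simp add: numeral_2_eq_2)
qed

section \<open>Arithmetic, case distinction and decidable predicates\<close>

lemma computable_id: "computable (\<lambda>x. x)"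
  unfolding computable_iff_recursive by (rule recursive_nth) simp

lemma recursive_add:
  assumes "recursive n F" and "recursive n G"
  shows "recursive n (\<lambda>xs. F xs + G xs)"
proof -
  have "rec_nat b (\<lambda>k y. Suc y) a = a + b" for a b :: nat
    by (induction a) auto
  then show ?thesis
    using recursive_rec_nat[OF computable_id, where h = "\<lambda>k y x. Suc y", OF _ assms]
    by (simp add: recursive_Suc recursive_nth)
qed

lemma recursive_pred:
  assumes "recursive n F"
  shows "recursive n (\<lambda>xs. F xs - 1)"
proof -
  have "rec_nat 0 (\<lambda>k y. k) a = a - 1" for a :: nat
    by (induction a) auto
  moreover have "computable (\<lambda>x. 0)"
    unfolding computable_iff_recursive by (rule recursive_const)
  ultimately show ?thesis
    using recursive_rec_nat[where g = "\<lambda>x. 0" and h = "\<lambda>k y x. k", OF _ _ assms assms]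
    by (simp add: recursive_nth)
qed

lemma recursive_diff:
  assumes "recursive n F" and "recursive n G"
  shows "recursive n (\<lambda>xs. F xs - G xs)"
proof -
  have "rec_nat b (\<lambda>k y. y - 1) a = b - a" for a b :: nat
    by (induction a) auto
  then show ?thesis
    \<comment> \<open>The subtrahend counts the rounds, hence the swapped assumptions.\<close>
    using recursive_rec_nat[OF computable_id, where h = "\<lambda>k y x. y - 1", OF _ assms(2,1)]
    by (simp add: recursive_pred[unfolded One_nat_def] recursive_nth)
qed

text \<open>Truth is coded by \<open>0\<close>, so that a search for a zero is a search for a true
  instance.\<close>

definition decidable :: "nat \<Rightarrow> (nat list \<Rightarrow> bool) \<Rightarrow> bool" where
  "decidable n P \<longleftrightarrow> recursive n (\<lambda>xs. if P xs then 0 else 1)"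

lemma recursive_if:
  assumes "decidable n P" and "recursive n F" and "recursive n G"
  shows "recursive n (\<lambda>xs. if P xs then F xs else G xs)"
proof -
  have "recursive (Suc 2) (\<lambda>xs. if xs ! 0 = 0 then xs ! 1 else xs ! 2)"
    \<comment> \<open>The recursion step sees counter, previous value and the two branches, so index
      \<open>3\<close> is the else branch.\<close>
    by (rule recursive_primrec[of 2 "\<lambda>xs. xs ! 0" "\<lambda>xs. xs ! 3"])
      (auto intro: recursive_nth simp: numeral_3_eq_3 numeral_2_eq_2)
  then have "recursive 3 (\<lambda>xs. if xs ! 0 = 0 then xs ! 1 else xs ! 2)"
    by (simp add: numeral_3_eq_3)
  from recursive_ternary[OF this assms(1)[unfolded decidable_def] assms(2,3)]
  show ?thesis by (rule recursive_cong) auto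
qed

lemma decidable_eq_0:
  assumes "recursive n F"
  shows "decidable n (\<lambda>xs. F xs = 0)"
proof -
  \<comment> \<open>Truncated subtraction makes this the sign function.\<close>
  have "recursive n (\<lambda>xs. 1 - (1 - F xs))"
    by (intro recursive_diff recursive_const assms)
  then show ?thesis
    unfolding decidable_def by (rule recursive_cong) auto
qed

lemma decidable_less:
  assumes "recursive n F" and "recursive n G"
  shows "decidable n (\<lambda>xs. F xs < G xs)"
proof -
  have "decidable n (\<lambda>xs. Suc (F xs) - G xs = 0)"
    by (intro decidable_eq_0 recursive_diff recursive_Suc assms)
  then show ?thesis by (simp add: Suc_le_eq)
qed

lemma decidable_eq:
  assumes "recursive n F" and "recursive n G"
  shows "decidable n (\<lambda>xs. F xs = G xs)"
proof -
  have "decidable n (\<lambda>xs. (F xs - G xs) + (G xs - F xs) = 0)"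
    by (intro decidable_eq_0 recursive_add recursive_diff assms)
  moreover have "(a - b) + (b - a) = 0 \<longleftrightarrow> a = b" for a b :: nat
    by auto
  ultimately show ?thesis by (simp only:)
qed

lemma decidable_conj:
  assumes "decidable n P" and "decidable n Q"
  shows "decidable n (\<lambda>xs. P xs \<and> Q xs)"
proof -
  have "recursive n (\<lambda>xs. if P xs then if Q xs then 0 else 1 else 1)"
    by (intro recursive_if recursive_const assms)
  then show ?thesis
    unfolding decidable_def by (rule recursive_cong) auto
qed

section \<open>Pairing\<close>

lemma recursive_triangle:
  assumes "recursive n F"
  shows "recursive n (\<lambda>xs. triangle (F xs))"
proof -
  have "rec_nat 0 (\<lambda>k y. y + Suc k) a = triangle a" for a :: nat
    by (induction a) auto
  moreover have "computable (\<lambda>x. 0)"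
    unfolding computable_iff_recursive by (rule recursive_const)
  moreover have "recursive 3 (\<lambda>xs. xs ! 1 + Suc (xs ! 0))"
    by (intro recursive_add recursive_Suc recursive_nth) simp_all
  ultimately show ?thesis
    using recursive_rec_nat[where g = "\<lambda>x. 0" and h = "\<lambda>k y x. y + Suc k", OF _ _ assms assms]
    by simp
qed

lemma recursive_prod_encode:
  assumes "recursive n F" and "recursive n G"
  shows "recursive n (\<lambda>xs. prod_encode (F xs, G xs))"
  unfolding prod_encode_def prod.case
  by (intro recursive_add recursive_triangle assms)

definition pfst :: "nat \<Rightarrow> nat" where
  "pfst x = fst (prod_decode x)"

definition psnd :: "nat \<Rightarrow> nat" where
  "psnd x = snd (prod_decode x)"

lemma pfst_prod_encode [simp]: "pfst (prod_encode (a, b)) = a"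
  and psnd_prod_encode [simp]: "psnd (prod_encode (a, b)) = b"
  by (simp_all add: pfst_def psnd_def)

lemma prod_encode_cases:
  obtains a b where "x = prod_encode (a, b)"
  by (metis prod_decode_inverse surj_pair)

text \<open>The index of the diagonal on which the pair coded by \<open>x\<close> lies.\<close>

definition diagonal :: "nat \<Rightarrow> nat" where
  "diagonal x = (LEAST s. Suc x - triangle (Suc s) = 0)"

text \<open>The codes on diagonal \<open>s\<close> run from \<open>triangle s\<close> up to, but
  excluding, \<open>triangle (Suc s)\<close>; so the diagonal is the least \<open>s\<close> whose
  upper end exceeds the code.\<close>

lemma diagonal_prod_encode: "diagonal (prod_encode (a, b)) = a + b"
  unfolding diagonal_def prod_encode_def prod.case
proof (rule Least_equality)
  show "Suc (triangle (a + b) + a) - triangle (Suc (a + b)) = 0" by simp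
  fix s
  assume s: "Suc (triangle (a + b) + a) - triangle (Suc s) = 0"
  have "mono triangle" by (rule mono_iff_le_Suc[THEN iffD2]) simp
  then have "triangle (Suc s) \<le> triangle (a + b)" if "s < a + b"
    using monoD[OF \<open>mono triangle\<close>, of "Suc s" "a + b"] that by simp
  then show "a + b \<le> s" using s by (metis Suc_le_eq diff_is_0_eq le_add1 not_le order_trans)
qed

text \<open>A code exceeds the first code of its diagonal by its first component. This expresses
  decoding through functions already known to be recursive.\<close>

lemma pfst_eq: "pfst x = x - triangle (diagonal x)"
  by (cases x rule: prod_encode_cases) (simp add: diagonal_prod_encode, simp add: prod_encode_def)

lemma psnd_eq: "psnd x = diagonal x - pfst x"
  by (cases x rule: prod_encode_cases) (simp add: diagonal_prod_encode)

lemma recursive_diagonal: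
  assumes "recursive n F"
  shows "recursive n (\<lambda>xs. diagonal (F xs))"
proof (rule recursive_unary[OF _ assms])
  have *: "recursive (Suc 1) (\<lambda>xs. Suc (xs ! 1) - triangle (Suc (xs ! 0)))"
    by (intro recursive_diff recursive_Suc recursive_triangle recursive_nth) simp_all
  have ex: "\<exists>y. Suc x - triangle (Suc y) = 0" for x
    \<comment> \<open>\<open>triangle (Suc x)\<close> is at least \<open>Suc x\<close>.\<close>
    by (rule exI[of _ x]) simp
  from recursive_Least[OF *] ex show "computable diagonal"
    unfolding computable_iff_recursive diagonal_def by simp
qed

lemma recursive_pfst: "recursive n F \<Longrightarrow> recursive n (\<lambda>xs. pfst (F xs))"
  unfolding pfst_eq by (intro recursive_diff recursive_triangle recursive_diagonal)

lemma recursive_psnd: "recursive n F \<Longrightarrow> recursive n (\<lambda>xs. psnd (F xs))"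
  unfolding psnd_eq by (intro recursive_diff recursive_diagonal recursive_pfst)

lemmas recursive_intros =
  recursive_const recursive_Suc recursive_add recursive_pred recursive_diff recursive_if
  recursive_prod_encode recursive_pfst recursive_psnd
  decidable_eq decidable_less decidable_conj

section \<open>Recognizing sentences\<close>

text \<open>
  A stack entry \<open>(k, d, c)\<close> claims that \<open>c\<close> codes a formula (\<open>k = 0\<close>), a term (\<open>k = 1\<close>) or a list of
  \<open>k - 2\<close> terms, over the given language and with all free variables below \<open>d\<close>.
\<close>

definition push :: "nat \<Rightarrow> nat \<Rightarrow> nat \<Rightarrow> nat \<Rightarrow> nat" where
  "push k d c r = Suc (prod_encode (prod_encode (k, prod_encode (d, c)), r))"

text \<open>The outer \<open>Suc\<close> of \<open>push\<close> reserves \<open>0\<close> for the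
  empty stack.\<close>

lemma push_neq_0 [simp]: "push k d c r \<noteq> 0" "0 \<noteq> push k d c r"
  by (simp_all add: push_def)

lemma push_inject [simp]:
  "push k d c r = push k' d' c' r' \<longleftrightarrow> k = k' \<and> d = d' \<and> c = c' \<and> r = r'"
  by (auto simp: push_def)

lemma recursive_push:
  "recursive n K \<Longrightarrow> recursive n D \<Longrightarrow> recursive n C \<Longrightarrow> recursive n R \<Longrightarrow>
    recursive n (\<lambda>xs. push (K xs) (D xs) (C xs) (R xs))"
  unfolding push_def by (intro recursive_intros)

text \<open>
  \<open>fa\<close> and \<open>ra\<close> give the arity plus one of a symbol, and \<open>0\<close> if it is not in the language. A false
  claim at the top leaves the whole stack \<open>s\<close> unchanged, so that it is never emptied.
\<close>

definition check_top ::
    "(nat \<Rightarrow> nat) \<Rightarrow> (nat \<Rightarrow> nat) \<Rightarrow> nat \<Rightarrow> nat \<Rightarrow> nat \<Rightarrow> nat \<Rightarrow> nat \<Rightarrow> nat" where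
  "check_top fa ra s k d c r =
    (if k = 0 then
       if pfst c = 0 then if psnd c = 0 then r else s
       else if pfst c = 1 then
         if ra (pfst (psnd c)) = 0 then s
         else push (Suc (ra (pfst (psnd c)))) d (psnd (psnd c)) r
       else if pfst c = 2 then push 1 d (pfst (psnd c)) (push 1 d (psnd (psnd c)) r)
       else if pfst c = 3 then push 0 d (pfst (psnd c)) (push 0 d (psnd (psnd c)) r)
       else if pfst c = 4 then push 0 (Suc d) (psnd c) r
       else s
     else if k = 1 then
       if pfst c = 0 then if psnd c < d then r else s
       else if pfst c = 1 then
         if fa (pfst (psnd c)) = 0 then s
         else push (Suc (fa (pfst (psnd c)))) d (psnd (psnd c)) r
       else s
     else if k = 2 then if c = 0 then r else s
     else if c = 0 then s
     else push 1 d (pfst (c - 1)) (push (k - 1) d (psnd (c - 1)) r))"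

definition check_step :: "(nat \<Rightarrow> nat) \<Rightarrow> (nat \<Rightarrow> nat) \<Rightarrow> nat \<Rightarrow> nat" where
  "check_step fa ra s =
    (if s = 0 then 0
     else check_top fa ra s (pfst (pfst (s - 1))) (pfst (psnd (pfst (s - 1))))
       (psnd (psnd (pfst (s - 1)))) (psnd (s - 1)))"

lemma check_step_0 [simp]: "check_step fa ra 0 = 0"
  by (simp add: check_step_def)

lemma check_step_push [simp]:
  "check_step fa ra (push k d c r) = check_top fa ra (push k d c r) k d c r"
  by (simp add: check_step_def) (simp add: push_def)

lemma stack_cases:
  obtains "s = 0" | k d c r where "s = push k d c r"
proof (cases s)
  case 0
  then show ?thesis using that(1) by blast
next
  case (Suc x)
  then show ?thesis using that(2) unfolding push_def by (metis prod_encode_cases)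
qed

lemma recursive_check_step:
  assumes "computable fa" and "computable ra" and "recursive n F"
  shows "recursive n (\<lambda>xs. check_step fa ra (F xs))"
proof -
  have check_top: "recursive n (\<lambda>xs. check_top fa ra (S xs) (K xs) (D xs) (C xs) (R xs))"
    if "recursive n S" "recursive n K" "recursive n D" "recursive n C" "recursive n R"
    for S K D C R
    unfolding check_top_def
    by (intro recursive_intros recursive_push recursive_unary[OF assms(1)]
        recursive_unary[OF assms(2)] that)
  show ?thesis
    unfolding check_step_def by (intro recursive_intros check_top assms(3))
qed

text \<open>The number of iterations is an argument here, so that termination of the checker becomes
  a search over one number.\<close>

lemma recursive_funpow:
  assumes "computable g" and "recursive n F" and "recursive n G"
  shows "recursive n (\<lambda>xs. (g ^^ F xs) (G xs))"
proof -
  have "rec_nat x (\<lambda>k y. g y) m = (g ^^ m) x" for m x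
    by (induction m) auto
  moreover have "recursive 3 (\<lambda>xs. g (xs ! 1))"
    by (rule recursive_unary[OF assms(1) recursive_nth]) simp
  ultimately show ?thesis
    using recursive_rec_nat[OF computable_id, where h = "\<lambda>k y x. g y", OF _ assms(2,3)] by simp
qed

definition fun_code :: "lang \<Rightarrow> nat \<Rightarrow> nat" where
  "fun_code L n = (case fun_arity L n of None \<Rightarrow> 0 | Some k \<Rightarrow> Suc k)"

definition rel_code :: "lang \<Rightarrow> nat \<Rightarrow> nat" where
  "rel_code L n = (case rel_arity L n of None \<Rightarrow> 0 | Some k \<Rightarrow> Suc k)"

definition tm_below :: "lang \<Rightarrow> nat \<Rightarrow> tm \<Rightarrow> bool" where
  "tm_below L d t \<longleftrightarrow> tm_in L t \<and> tm_vars t \<subseteq> {..<d}"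

text \<open>The bound \<open>d\<close> makes the notion recursive through quantifiers; sentences are
  the case \<open>d = 0\<close>.\<close>

definition fm_below :: "lang \<Rightarrow> nat \<Rightarrow> fm \<Rightarrow> bool" where
  "fm_below L d A \<longleftrightarrow> fm_in L A \<and> free_vars A \<subseteq> {..<d}"

lemma tm_below_simps [simp]:
  "tm_below L d (Var i) \<longleftrightarrow> i < d"
  "tm_below L d (Fn f ts) \<longleftrightarrow> fun_code L f = Suc (length ts) \<and> list_all (tm_below L d) ts"
  by (auto simp: tm_below_def fun_code_def list_all_iff split: option.splits)

lemma fm_below_simps [simp]:
  "fm_below L d Fls"
  "fm_below L d (Rel f ts) \<longleftrightarrow> rel_code L f = Suc (length ts) \<and> list_all (tm_below L d) ts"
  "fm_below L d (Eq s t) \<longleftrightarrow> tm_below L d s \<and> tm_below L d t"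
  "fm_below L d (Imp A B) \<longleftrightarrow> fm_below L d A \<and> fm_below L d B"
  by (auto simp: tm_below_def fm_below_def rel_code_def list_all_iff split: option.splits)

text \<open>Index \<open>0\<close> of the body is bound and index \<open>Suc n\<close> is the outer
  \<open>n\<close>, so the bound rises by one.\<close>

lemma fm_below_All [simp]: "fm_below L d (All A) \<longleftrightarrow> fm_below L (Suc d) A"
proof -
  have "{n. Suc n \<in> V} \<subseteq> {..<d} \<longleftrightarrow> V \<subseteq> {..<Suc d}" for V
    by (auto simp: subset_iff less_Suc_eq_0_disj) (metis not0_implies_Suc)
  then show ?thesis by (simp add: fm_below_def)
qed

section \<open>Completeness of the checker: true claims get removed\<close>

context
  fixes L :: lang
begin

abbreviation step :: "nat \<Rightarrow> nat" where
  "step \<equiv> check_step (fun_code L) (rel_code L)"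

definition reaches :: "nat \<Rightarrow> nat \<Rightarrow> bool" where
  "reaches s r \<longleftrightarrow> (\<exists>n. (step ^^ n) s = r)"

lemma reaches_refl: "reaches s s"
  unfolding reaches_def by (metis funpow_0)

lemma reaches_step: "reaches (step s) r \<Longrightarrow> reaches s r"
  unfolding reaches_def by (metis comp_apply funpow_Suc_right)

lemma reaches_trans: "reaches s t \<Longrightarrow> reaches t r \<Longrightarrow> reaches s r"
  unfolding reaches_def by (metis comp_apply funpow_add)

text \<open>The hypothesis concerns the members only, so that the induction hypothesis for terms can
  discharge it.\<close>

lemma reaches_tms:
  assumes "\<And>t r. t \<in> set ts \<Longrightarrow> reaches (push 1 d (tm_code t) r) r"
  shows "reaches (push (Suc (Suc (length ts))) d (list_encode (map tm_code ts)) r) r"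
  using assms
proof (induction ts)
  case Nil
  show ?case by (rule reaches_step) (simp add: check_top_def reaches_refl)
next
  case (Cons t ts)
  have "reaches (push 1 d (tm_code t)
      (push (Suc (Suc (length ts))) d (list_encode (map tm_code ts)) r)) r"
    using Cons by (meson list.set_intros reaches_trans)
  \<comment> \<open>\<open>list_encode\<close> maps a nonempty list to the successor of a pair of
    head and tail, which is why the checker splits \<open>c - 1\<close>.\<close>
  then show ?case by - (rule reaches_step, simp add: check_top_def)
qed

lemma reaches_tm: "tm_below L d t \<Longrightarrow> reaches (push 1 d (tm_code t) r) r"
proof (induction t arbitrary: r)
  case (Var i)
  then show ?case by - (rule reaches_step, simp add: check_top_def reaches_refl)
next
  case (Fn f ts)
  then have "reaches (push (Suc (Suc (length ts))) d (list_encode (map tm_code ts)) r) r"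
    by (intro reaches_tms) (simp add: list_all_iff)
  then show ?case using Fn.prems by - (rule reaches_step, simp add: check_top_def)
qed

text \<open>The remaining stack \<open>r\<close> varies because the first part of a formula is
  checked above the second; \<open>d\<close> varies because quantifiers raise it.\<close>

lemma reaches_fm: "fm_below L d A \<Longrightarrow> reaches (push 0 d (godel_num A) r) r"
proof (induction A arbitrary: d r)
  case Fls
  show ?case by (rule reaches_step) (simp add: check_top_def reaches_refl)
next
  case (Rel f ts)
  \<comment> \<open>\<open>rel_code\<close> gives the arity plus one and lists are tagged by length
    plus two, so the checker's single \<open>Suc\<close> on the code yields this tag.\<close>
  then have "reaches (push (Suc (Suc (length ts))) d (list_encode (map tm_code ts)) r) r"
    by (intro reaches_tms reaches_tm) (simp add: list_all_iff)
  then show ?case using Rel.prems by - (rule reaches_step, simp add: check_top_def)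
next
  case (Eq s t)
  then have "reaches (push 1 d (tm_code s) (push 1 d (tm_code t) r)) r"
    using reaches_tm reaches_trans by (meson fm_below_simps(3))
  then show ?case by - (rule reaches_step, simp add: check_top_def)
next
  case (Imp A B)
  then have "reaches (push 0 d (godel_num A) (push 0 d (godel_num B) r)) r"
    using reaches_trans by (meson fm_below_simps(4))
  then show ?case by - (rule reaches_step, simp add: check_top_def)
next
  case (All A)
  then have "reaches (push 0 (Suc d) (godel_num A) r) r" by simp
  then show ?case by - (rule reaches_step, simp add: check_top_def)
qed

section \<open>Soundness of the checker: only true claims get removed\<close>

definition claim :: "nat \<Rightarrow> nat \<Rightarrow> nat \<Rightarrow> bool" where
  "claim k d c \<longleftrightarrow>
    (if k = 0 then \<exists>A. c = godel_num A \<and> fm_below L d A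
     else if k = 1 then \<exists>t. c = tm_code t \<and> tm_below L d t
     else \<exists>ts. c = list_encode (map tm_code ts) \<and> k = Suc (Suc (length ts)) \<and>
       list_all (tm_below L d) ts)"

lemma claim_simps:
  "claim 0 d c \<longleftrightarrow> (\<exists>A. c = godel_num A \<and> fm_below L d A)"
  "claim (Suc 0) d c \<longleftrightarrow> (\<exists>t. c = tm_code t \<and> tm_below L d t)"
  "claim (Suc (Suc m)) d c \<longleftrightarrow>
    (\<exists>ts. c = list_encode (map tm_code ts) \<and> length ts = m \<and> list_all (tm_below L d) ts)"
  by (auto simp: claim_def)

text \<open>This property is carried backwards along a run, starting from the empty stack.\<close>

inductive true_stack :: "nat \<Rightarrow> bool" where
  true_stack_0: "true_stack 0"
| true_stack_push: "claim k d c \<Longrightarrow> true_stack r \<Longrightarrow> true_stack (push k d c r)"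

lemma true_stack_push_iff [simp]: "true_stack (push k d c r) \<longleftrightarrow> claim k d c \<and> true_stack r"
  by (auto elim: true_stack.cases intro: true_stack_push)

text \<open>The claims that replace the top entry provide the components from which a formula with
  code \<open>c\<close> is assembled. A rejected claim leaves the stack as it was, so the assumption
  is then the conclusion.\<close>

lemma true_stack_check_fm:
  assumes "true_stack (check_top (fun_code L) (rel_code L) (push 0 d c r) 0 d c r)"
  shows "true_stack (push 0 d c r)"
proof -
  obtain tag b where c: "c = prod_encode (tag, b)" by (rule prod_encode_cases)
  obtain x y where b: "b = prod_encode (x, y)" by (rule prod_encode_cases)
  \<comment> \<open>The last disjunct collects all rejections.\<close>
  have "tag = 0 \<and> b = 0 \<or> tag = 1 \<and> rel_code L x \<noteq> 0 \<or> tag = 2 \<or> tag = 3 \<or> tag = 4 \<or>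
      check_top (fun_code L) (rel_code L) (push 0 d c r) 0 d c r = push 0 d c r"
    by (cases "tag = 0") (auto simp: check_top_def c b)
  then consider "tag = 0" "b = 0" | "tag = 1" "rel_code L x \<noteq> 0" | "tag = 2" | "tag = 3" | "tag = 4"
    | "check_top (fun_code L) (rel_code L) (push 0 d c r) 0 d c r = push 0 d c r"
    by blast
  then show ?thesis
  proof cases
    case 1
    then have "c = godel_num Fls" by (simp add: c)
    moreover have "true_stack r" using assms 1 by (simp add: check_top_def c)
    ultimately show ?thesis unfolding true_stack_push_iff claim_simps
      using fm_below_simps(1) by blast
  next
    case 2
    then obtain m where m: "rel_code L x = Suc m" using not0_implies_Suc by blast
    with assms 2 obtain ts where "y = list_encode (map tm_code ts)" "length ts = m"
      "list_all (tm_below L d) ts" "true_stack r"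
      by (auto simp: check_top_def c b claim_simps)
    then have "c = godel_num (Rel x ts)" "fm_below L d (Rel x ts)"
      using 2 m by (simp_all add: c b)
    with \<open>true_stack r\<close> show ?thesis unfolding true_stack_push_iff claim_simps by blast
  next
    case 3
    with assms obtain s t where "x = tm_code s" "y = tm_code t"
      "tm_below L d s" "tm_below L d t" "true_stack r"
      by (auto simp: check_top_def c b claim_simps)
    then have "c = godel_num (Eq s t)" "fm_below L d (Eq s t)"
      using 3 by (simp_all add: c b)
    with \<open>true_stack r\<close> show ?thesis unfolding true_stack_push_iff claim_simps by blast
  next
    case 4
    with assms obtain A B where "x = godel_num A" "y = godel_num B"
      "fm_below L d A" "fm_below L d B" "true_stack r"
      by (auto simp: check_top_def c b claim_simps)
    then have "c = godel_num (Imp A B)" "fm_below L d (Imp A B)"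
      using 4 by (simp_all add: c b)
    with \<open>true_stack r\<close> show ?thesis unfolding true_stack_push_iff claim_simps by blast
  next
    case 5
    with assms obtain A where "b = godel_num A" "fm_below L (Suc d) A" "true_stack r"
      by (auto simp: check_top_def c claim_simps)
    then have "c = godel_num (All A)" "fm_below L d (All A)"
      using 5 by (simp_all add: c)
    with \<open>true_stack r\<close> show ?thesis unfolding true_stack_push_iff claim_simps by blast
  next
    case 6
    then show ?thesis using assms by simp
  qed
qed

lemma true_stack_check_tm:
  assumes "true_stack (check_top (fun_code L) (rel_code L) (push 1 d c r) 1 d c r)"
  shows "true_stack (push 1 d c r)"
proof -
  obtain tag b where c: "c = prod_encode (tag, b)" by (rule prod_encode_cases)
  obtain x y where b: "b = prod_encode (x, y)" by (rule prod_encode_cases)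
  have "tag = 0 \<and> b < d \<or> tag = 1 \<and> fun_code L x \<noteq> 0 \<or>
      check_top (fun_code L) (rel_code L) (push 1 d c r) 1 d c r = push 1 d c r"
    by (auto simp: check_top_def c b)
  then consider "tag = 0" "b < d" | "tag = 1" "fun_code L x \<noteq> 0"
    | "check_top (fun_code L) (rel_code L) (push 1 d c r) 1 d c r = push 1 d c r"
    by blast
  then show ?thesis
  proof cases
    case 1
    then have "c = tm_code (Var b)" "tm_below L d (Var b)" by (simp_all add: c)
    moreover have "true_stack r" using assms 1 by (simp add: check_top_def c)
    ultimately show ?thesis unfolding true_stack_push_iff One_nat_def claim_simps by blast
  next
    case 2
    then obtain m where m: "fun_code L x = Suc m" using not0_implies_Suc by blast
    with assms 2 obtain ts where "y = list_encode (map tm_code ts)" "length ts = m"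
      "list_all (tm_below L d) ts" "true_stack r"
      by (auto simp: check_top_def c b claim_simps)
    then have "c = tm_code (Fn x ts)" "tm_below L d (Fn x ts)"
      using 2 m by (simp_all add: c b)
    with \<open>true_stack r\<close> show ?thesis
      unfolding true_stack_push_iff One_nat_def claim_simps by blast
  next
    case 3
    then show ?thesis using assms by simp
  qed
qed

lemma true_stack_check_tms:
  assumes "true_stack
    (check_top (fun_code L) (rel_code L) (push (Suc (Suc m)) d c r) (Suc (Suc m)) d c r)"
  shows "true_stack (push (Suc (Suc m)) d c r)"
proof (cases m)
  case 0
  then show ?thesis using assms by (simp add: check_top_def claim_simps split: if_splits)
next
  case (Suc m')
  show ?thesis
  proof (cases c)
    case 0
    then show ?thesis using assms Suc by (simp add: check_top_def)
  next
    case (Suc b)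
    obtain x y where b: "b = prod_encode (x, y)" by (rule prod_encode_cases)
    from assms obtain t ts where "x = tm_code t" "tm_below L d t" "length ts = m'"
      "y = list_encode (map tm_code ts)" "list_all (tm_below L d) ts" "true_stack r"
      by (auto simp: check_top_def Suc b \<open>m = Suc m'\<close> claim_simps)
    then have "c = list_encode (map tm_code (t # ts))" "length (t # ts) = m"
      "list_all (tm_below L d) (t # ts)"
      by (simp_all add: Suc b \<open>m = Suc m'\<close>)
    with \<open>true_stack r\<close> show ?thesis unfolding true_stack_push_iff claim_simps by blast
  qed
qed

lemma true_stack_step: "true_stack (step s) \<Longrightarrow> true_stack s"
proof (cases s rule: stack_cases)
  case 1
  then show ?thesis by (simp add: true_stack_0)
next
  case (2 k d c r)
  assume "true_stack (step s)"
  then have top: "true_stack (check_top (fun_code L) (rel_code L) (push k d c r) k d c r)"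
    by (simp add: 2)
  consider "k = 0" | "k = 1" | m where "k = Suc (Suc m)"
    by (metis One_nat_def not0_implies_Suc)
  then show ?thesis
    unfolding 2
    by cases (use top true_stack_check_fm true_stack_check_tm true_stack_check_tms in blast)+
qed

text \<open>The empty stack is true and every step reflects truth, so induction on the number of
  steps applies.\<close>

lemma reaches_0_true_stack: "reaches s 0 \<Longrightarrow> true_stack s"
proof -
  have "(step ^^ n) s = 0 \<Longrightarrow> true_stack s" for n
  proof (induction n arbitrary: s)
    case 0
    then show ?case by (simp add: true_stack_0)
  next
    case (Suc n)
    then show ?case by (metis comp_apply funpow_Suc_right true_stack_step)
  qed
  then show "reaches s 0 \<Longrightarrow> true_stack s" unfolding reaches_def by blast
qed

lemma sentence_iff_check:
  "c \<in> godel_num ` sentences L \<longleftrightarrow> (\<exists>n. (step ^^ n) (push 0 0 c 0) = 0)"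
proof -
  have "c \<in> godel_num ` sentences L \<longleftrightarrow> claim 0 0 c"
    by (auto simp: claim_simps fm_below_def sentences_def)
  also have "\<dots> \<longleftrightarrow> reaches (push 0 0 c 0) 0"
  proof
    assume "claim 0 0 c"
    then show "reaches (push 0 0 c 0) 0" by (auto simp: claim_simps reaches_fm)
  next
    assume "reaches (push 0 0 c 0) 0"
    then have "true_stack (push 0 0 c 0)" by (rule reaches_0_true_stack)
    then show "claim 0 0 c" by simp
  qed
  finally show ?thesis unfolding reaches_def .
qed

end

text \<open>\<open>3\<close> is the tag of \<open>Imp\<close>. The code of an implication displays
  its antecedent, so no search for a preimage is made: \<open>x\<close> is taken apart, its
  consequent compared with \<open>f\<close> of its antecedent, and \<open>t\<close> bounds the run
  that certifies the antecedent as a sentence.\<close>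

lemma ce_graph_image:
  assumes "computable_lang L" and "computable f"
  shows "ce ((\<lambda>c. prod_encode (3, prod_encode (c, f c))) ` godel_num ` sentences L)"
proof (rule ce_projection)
  define check where "check t x \<longleftrightarrow> pfst x = 3 \<and> psnd (psnd x) = f (pfst (psnd x)) \<and>
    (check_step (fun_code L) (rel_code L) ^^ t) (push 0 0 (pfst (psnd x)) 0) = 0" for t x
  let ?F = "\<lambda>xs. if check (xs ! 0) (xs ! 1) then 0 else 1 :: nat"
  have "computable (fun_code L)" "computable (rel_code L)"
    using assms(1) unfolding computable_lang_def fun_code_def rel_code_def by simp_all
  then have "computable (check_step (fun_code L) (rel_code L))"
    unfolding computable_iff_recursive[of "check_step _ _"]
    by (rule recursive_check_step) (rule recursive_nth, simp)
  then show "recursive 2 ?F"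
    unfolding check_def
    by (intro recursive_intros recursive_push recursive_funpow recursive_unary[OF assms(2)]
        recursive_nth) simp_all
  fix x
  obtain a b where x: "x = prod_encode (a, b)" by (rule prod_encode_cases)
  obtain c e where b: "b = prod_encode (c, e)" by (rule prod_encode_cases)
  have "x \<in> (\<lambda>c. prod_encode (3, prod_encode (c, f c))) ` godel_num ` sentences L \<longleftrightarrow>
      a = 3 \<and> e = f c \<and> c \<in> godel_num ` sentences L"
    unfolding x b by auto
  also have "\<dots> \<longleftrightarrow> (\<exists>t. ?F [t, x] = 0)"
    unfolding sentence_iff_check check_def by (auto simp: x b)
  finally show "x \<in> (\<lambda>c. prod_encode (3, prod_encode (c, f c))) ` godel_num ` sentences L \<longleftrightarrow>
      (\<exists>t. ?F [t, x] = 0)" .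
qed

section \<open>Provability\<close>

text \<open>\<open>\<Delta>\<close> must vary in the induction, since \<open>ImpI\<close> and
  \<open>Classical\<close> extend the hypotheses and \<open>AllI\<close> shifts them.\<close>

lemma proves_weaken: "proves L \<Gamma> A \<Longrightarrow> \<Gamma> \<subseteq> \<Delta> \<Longrightarrow> proves L \<Delta> A"
proof (induction arbitrary: \<Delta> rule: proves.induct)
  case (ImpI A \<Gamma> B)
  then show ?case by (meson insert_mono proves.ImpI)
next
  case (Classical A \<Gamma>)
  then show ?case by (meson insert_mono proves.Classical)
next
  case (AllI \<Gamma> A)
  then show ?case by (meson image_mono proves.AllI)
qed (auto intro: proves.intros)

lemma proves_Imp_conclusion:
  assumes "fm_in L A" and "proves L \<Gamma> B"
  shows "proves L \<Gamma> (Imp A B)"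
  using assms by (auto intro: proves.ImpI proves_weaken)

text \<open>Ex falso is \<open>Classical\<close> with the hypothesis \<open>Neg B\<close> added by
  weakening.\<close>

lemma proves_Imp_refuted:
  assumes "fm_in L A" and "fm_in L B" and "proves L (insert A \<Gamma>) Fls"
  shows "proves L \<Gamma> (Imp A B)"
  using assms by (auto intro!: proves.ImpI proves.Classical[of L B] elim: proves_weaken)

lemma independent_Imp:
  assumes "fm_in L A" and "fm_in L B" and "independent L (insert A \<Gamma>) B"
  shows "independent L (insert A \<Gamma>) (Imp A B)"
  unfolding independent_def
proof (intro conjI notI)
  assume "proves L (insert A \<Gamma>) (Imp A B)"
  then have "proves L (insert A \<Gamma>) B"
    using assms(1) by (auto intro: proves.ImpE proves.Assm)
  then show False using assms(3) by (simp add: independent_def)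
next
  assume neg: "proves L (insert A \<Gamma>) (Neg (Imp A B))"
  \<comment> \<open>A refutation of \<open>Imp A B\<close> becomes one of \<open>B\<close>: under
    the assumption \<open>B\<close> the implication is provable.\<close>
  have "proves L (insert B (insert A \<Gamma>)) (Neg (Imp A B))"
    using neg by (rule proves_weaken) blast
  moreover have "proves L (insert B (insert A \<Gamma>)) (Imp A B)"
    using assms(1,2) by (intro proves_Imp_conclusion) (auto intro: proves.Assm)
  ultimately have "proves L (insert B (insert A \<Gamma>)) Fls" by (rule proves.ImpE)
  then have "proves L (insert A \<Gamma>) (Neg B)" by (rule proves.ImpI[OF assms(2)])
  then show False using assms(3) by (simp add: independent_def)
qed

text \<open>Independence of \<open>B\<close> is assumed only conditionally, because the given
  witness promises nothing for sentences inconsistent with the theory.\<close>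

lemma consistent_Imp:
  assumes "consistent L \<Gamma>" and "fm_in L A" and "fm_in L B"
    and "consistent L (insert A \<Gamma>) \<Longrightarrow> independent L (insert A \<Gamma>) B"
  shows "consistent L (insert (Imp A B) \<Gamma>)"
  unfolding consistent_def
proof
  assume "proves L (insert (Imp A B) \<Gamma>) Fls"
  then have neg: "proves L \<Gamma> (Neg (Imp A B))"
    using assms(2,3) by (auto intro: proves.ImpI)
  show False
  proof (cases "consistent L (insert A \<Gamma>)")
    case True
    then have "independent L (insert A \<Gamma>) (Imp A B)"
      using assms by (intro independent_Imp) auto
    moreover have "proves L (insert A \<Gamma>) (Neg (Imp A B))"
      using neg by (rule proves_weaken) blast
    ultimately show ?thesis by (simp add: independent_def)
  next
    case False
    then have "proves L \<Gamma> (Imp A B)"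
      using assms(2,3) by (intro proves_Imp_refuted) (simp_all add: consistent_def)
    with neg have "proves L \<Gamma> Fls" by (rule proves.ImpE)
    then show ?thesis using assms(1) by (simp add: consistent_def)
  qed
qed

theorem theorem4p5:
  fixes L :: lang and U :: "fm set"
  assumes "ce_theory L U"
    and "consistent L U"
    and "eff_ef_ess_incomplete L U"
  shows "\<exists>X. ce_sentences L X \<and> eff_ef_ess_incomplete_in L X U \<and>
    (\<forall>\<phi>\<in>X. consistent L (U \<union> {\<phi>}))"
proof -
  obtain \<Phi> where \<Phi>: "computable_on_sentences L \<Phi>"
    and indep: "\<And>\<phi>. \<phi> \<in> sentences L \<Longrightarrow> consistent L (insert \<phi> U) \<Longrightarrow>
      independent L (insert \<phi> U) (\<Phi> \<phi>)"
    using assms(3) unfolding eff_ef_ess_incomplete_def eff_ef_ess_incomplete_in_def by auto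
  obtain f where f: "computable f" "\<And>\<phi>. \<phi> \<in> sentences L \<Longrightarrow> f (godel_num \<phi>) = godel_num (\<Phi> \<phi>)"
    and closed: "\<And>\<phi>. \<phi> \<in> sentences L \<Longrightarrow> \<Phi> \<phi> \<in> sentences L"
    using \<Phi> unfolding computable_on_sentences_def by blast
  have fm_in: "fm_in L \<phi>" if "\<phi> \<in> sentences L" for \<phi>
    using that by (simp add: sentences_def)
  define \<Psi> where "\<Psi> \<phi> = Imp \<phi> (\<Phi> \<phi>)" for \<phi>
  \<comment> \<open>\<open>g\<close> is \<open>\<Psi>\<close> on codes.\<close>
  define g where "g c = prod_encode (3, prod_encode (c, f c))" for c
  have g: "g (godel_num \<phi>) = godel_num (\<Psi> \<phi>)" if "\<phi> \<in> sentences L" for \<phi>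
    using f(2)[OF that] by (simp add: g_def \<Psi>_def)
  have closed': "\<Psi> \<phi> \<in> sentences L" if "\<phi> \<in> sentences L" for \<phi>
    using that closed[OF that] by (simp add: \<Psi>_def sentences_def)
  have "computable g"
    unfolding g_def computable_iff_recursive
    by (intro recursive_intros recursive_unary[OF f(1)] recursive_nth) simp_all
  then have computable: "computable_on_sentences L \<Psi>"
    unfolding computable_on_sentences_def using g closed' by blast
  \<comment> \<open>\<open>\<Psi>\<close> ranges over all sentences, also those inconsistent with
    \<open>U\<close>, so only sentencehood of the antecedent has to be recognized.\<close>
  have "godel_num ` \<Psi> ` sentences L = g ` godel_num ` sentences L"
    by (simp add: image_image g cong: image_cong)
  also have "ce \<dots>"
    unfolding g_def
    using assms(1) f(1) by (intro ce_graph_image) (simp_all add: ce_theory_def)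
  finally have "ce_sentences L (\<Psi> ` sentences L)"
    unfolding ce_sentences_def using closed' by blast
  moreover have "eff_ef_ess_incomplete_in L (\<Psi> ` sentences L) U"
    unfolding eff_ef_ess_incomplete_in_def
    using computable fm_in closed indep by (auto simp: \<Psi>_def intro!: exI[of _ \<Psi>] independent_Imp)
  moreover have "consistent L (U \<union> {\<psi>})" if "\<psi> \<in> \<Psi> ` sentences L" for \<psi>
    using that assms(2) fm_in closed indep by (auto simp: \<Psi>_def intro!: consistent_Imp)
  ultimately show ?thesis by blast
qed

end
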